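(* Let $G$ be a semitopological group and let $X$ be an RN-approximable semitopological $G$-flow. Then $X$ is locally equicontinuous ($X\in\mathrm{LE}$), and every $G$-quasiminimal subspace of $X$ (for instance, every orbit) is equicontinuous.
   Context: A semitopological group is a group with a topology for which multiplication is separately continuous. A semitopological $G$-flow is a topological space $X$ with a separately continuous left action $G\times X\to X$ (the identity acts as the identity). A uniformity $\mu$ on a flow $X$ is compatible if it induces the topology of $X$. A point $z\in X$ is a point of $\mu$-equicontinuity of $(G,X)$ if for every $\varepsilon\in\mu$ there is a neighborhood $U$ of $z$ in $X$ with $(gx,gz)\in\varepsilon$ for all $x\in U$, $g\in G$. A flow is equicontinuous if for some compatible uniformity $\mu$ every point is a point of $\mu$-equicontinuity. A flow $X$ is locally equicontinuous ($X\in\mathrm{LE}$) if there is a compatible uniformity $\mu$ on $X$ such that every $z\in X$ is a point of $\mu|_{\overline{Gz}}$-equicontinuity of the subflow $(G,\overline{Gz})$, where $\overline{Gz}$ is the closure of the orbit in $X$ ($X$ need not be compact). A $G$-flow $Y$ (in particular a $G$-invariant subspace of $X$ with the relative topology) is quasiminimal if for every $y\in Y$ the closure of $Gy$ in $Y$ has nonempty interior in $Y$. For a real Banach space $V$: $\Theta(V)=\{\sigma\in L(V,V):\|\sigma\|\le1\}$; $B(V^* )$ is the closed unit ball of $V^*$ with the weak$^*$ topology. A $V$-representation of $(G,X)$ is a pair $(h,\alpha)$ where $h:G\to\Theta(V)$ is an antihomomorphism ($h(st)=h(t)h(s)$) continuous for the weak operator topology and $\alpha:X\to B(V^* )$ is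 weak$^*$ continuous with $\langle v,\alpha(gx)\rangle=\langle h(g)v,\alpha(x)\rangle$; the identity of $G$ is sent to the identity operator. $X$ is RN-approximable if there is a family of representations $(h_i,\alpha_i)$ of $(G,X)$ in Asplund spaces $V_i$ separating points and closed subsets of $X$ (the $\alpha_i$ separate the points of $X$, and for closed $F$, $x\notin F$, some $\alpha_i(x)\notin\overline{\alpha_i(F)}$). A Banach space is Asplund if every separable Banach subspace of it has separable dual. *)

theory Defs
  imports "HOL-Analysis.Analysis" "HOL-Algebra.Group_Action"
begin

section \<open>Semitopological groups and flows\<close>

text \<open>
  Topologies are objects of the type \<open>'a topology\<close>, so that invariant subspaces and orbit closures
  of a flow are again flows (via \<^const>\<open>subtopology\<close>).
\<close>

locale semitopological_group = group G for G (structure) and TG +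
  assumes topspace_group: "topspace TG = carrier G"
    and continuous_left: "a \<in> carrier G \<Longrightarrow> continuous_map TG TG (\<lambda>g. a \<otimes> g)"
    and continuous_right: "a \<in> carrier G \<Longrightarrow> continuous_map TG TG (\<lambda>g. g \<otimes> a)"

text \<open>
  The action is not required to be extensional, in contrast to the library's \<^locale>\<open>group_action\<close>;
  the same \<open>act\<close> therefore also acts on subflows.
\<close>

locale semitopological_flow = semitopological_group G TG for G (structure) and TG +
  fixes X :: "'x topology" and act :: "'a \<Rightarrow> 'x \<Rightarrow> 'x"
  assumes act_one: "x \<in> topspace X \<Longrightarrow> act \<one> x = x"
    and act_mult: "g \<in> carrier G \<Longrightarrow> k \<in> carrier G \<Longrightarrow> x \<in> topspace X \<Longrightarrow>
      act (g \<otimes> k) x = act g (act k x)"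
    and act_continuous_space: "g \<in> carrier G \<Longrightarrow> continuous_map X X (act g)"
    and act_continuous_group: "x \<in> topspace X \<Longrightarrow> continuous_map TG X (\<lambda>g. act g x)"

section \<open>Uniformities and equicontinuity\<close>

text \<open>
  The library has uniformities only as the type class \<^class>\<open>uniform_space\<close>. A uniformity on a set \<open>S\<close>
  is, as there, the filter of its entourages, here containing \<open>S \<times> S\<close>; \<^term>\<open>eventually (\<lambda>p. p \<in> \<epsilon>) \<mu>\<close>
  says that \<open>\<epsilon>\<close> contains an entourage.
\<close>

definition uniformity_on :: "'a set \<Rightarrow> ('a \<times> 'a) filter \<Rightarrow> bool" where
  "uniformity_on S \<mu> \<longleftrightarrow>
     \<mu> \<le> principal (S \<times> S) \<and>
     (\<forall>E. eventually E \<mu> \<longrightarrow>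
        (\<forall>x\<in>S. E (x, x)) \<and>
        eventually (\<lambda>(x, y). E (y, x)) \<mu> \<and>
        (\<exists>D. eventually D \<mu> \<and> (\<forall>x\<in>S. \<forall>y\<in>S. \<forall>z\<in>S. D (x, y) \<longrightarrow> D (y, z) \<longrightarrow> E (x, z))))"

text \<open>The uniformity induces the topology; the condition is the one of \<^class>\<open>open_uniformity\<close>.\<close>

definition compatible_uniformity :: "'a topology \<Rightarrow> ('a \<times> 'a) filter \<Rightarrow> bool" where
  "compatible_uniformity X \<mu> \<longleftrightarrow>
     uniformity_on (topspace X) \<mu> \<and>
     (\<forall>U. openin X U \<longleftrightarrow>
        U \<subseteq> topspace X \<and> (\<forall>x\<in>U. eventually (\<lambda>(x', y). x' = x \<longrightarrow> y \<in> U) \<mu>))"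

definition uniformity_restrict :: "('a \<times> 'a) filter \<Rightarrow> 'a set \<Rightarrow> ('a \<times> 'a) filter" where
  "uniformity_restrict \<mu> S = inf \<mu> (principal (S \<times> S))"

definition equicontinuity_point ::
  "('g, 'm) monoid_scheme \<Rightarrow> 'x topology \<Rightarrow> ('g \<Rightarrow> 'x \<Rightarrow> 'x) \<Rightarrow> ('x \<times> 'x) filter \<Rightarrow> 'x \<Rightarrow> bool" where
  "equicontinuity_point G X act \<mu> z \<longleftrightarrow>
     (\<forall>E. eventually E \<mu> \<longrightarrow>
        (\<exists>U. openin X U \<and> z \<in> U \<and> (\<forall>x\<in>U. \<forall>g\<in>carrier G. E (act g x, act g z))))"

definition equicontinuous_flow ::
  "('g, 'm) monoid_scheme \<Rightarrow> 'x topology \<Rightarrow> ('g \<Rightarrow> 'x \<Rightarrow> 'x) \<Rightarrow> bool" where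
  "equicontinuous_flow G X act \<longleftrightarrow>
     (\<exists>\<mu>. compatible_uniformity X \<mu> \<and> (\<forall>z\<in>topspace X. equicontinuity_point G X act \<mu> z))"

abbreviation orbit_closure ::
  "('g, 'm) monoid_scheme \<Rightarrow> 'x topology \<Rightarrow> ('g \<Rightarrow> 'x \<Rightarrow> 'x) \<Rightarrow> 'x \<Rightarrow> 'x set" where
  "orbit_closure G X act z \<equiv> X closure_of (orbit G act z)"

definition locally_equicontinuous ::
  "('g, 'm) monoid_scheme \<Rightarrow> 'x topology \<Rightarrow> ('g \<Rightarrow> 'x \<Rightarrow> 'x) \<Rightarrow> bool" where
  "locally_equicontinuous G X act \<longleftrightarrow>
     (\<exists>\<mu>. compatible_uniformity X \<mu> \<and>
        (\<forall>z\<in>topspace X.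
           equicontinuity_point G (subtopology X (orbit_closure G X act z)) act
             (uniformity_restrict \<mu> (orbit_closure G X act z)) z))"

definition quasiminimal_flow ::
  "('g, 'm) monoid_scheme \<Rightarrow> 'x topology \<Rightarrow> ('g \<Rightarrow> 'x \<Rightarrow> 'x) \<Rightarrow> bool" where
  "quasiminimal_flow G Y act \<longleftrightarrow>
     (\<forall>y\<in>topspace Y. Y interior_of (orbit_closure G Y act y) \<noteq> {})"

definition quasiminimal_subspace ::
  "('g, 'm) monoid_scheme \<Rightarrow> 'x topology \<Rightarrow> ('g \<Rightarrow> 'x \<Rightarrow> 'x) \<Rightarrow> 'x set \<Rightarrow> bool" where
  "quasiminimal_subspace G X act Y \<longleftrightarrow>
     Y \<subseteq> topspace X \<and> (\<forall>g\<in>carrier G. \<forall>y\<in>Y. act g y \<in> Y) \<and>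
     quasiminimal_flow G (subtopology X Y) act"

section \<open>Banach spaces, duals and Asplund spaces\<close>

text \<open>
  A family of Banach spaces cannot be a family of types, so a Banach space is a complete linear
  subspace \<open>V\<close> of some real normed space. This loses no generality: the members of an arbitrary family
  of Banach spaces embed isometrically, as complete subspaces, into their algebraic direct sum
  with the norm \<open>\<Sum>\<^sub>i \<parallel>v\<^sub>i\<parallel>\<close>. The ambient space plays no role beyond this: operators and functionals
  on \<open>V\<close> live on \<open>V\<close> only and are extensional, i.e. \<^const>\<open>undefined\<close> off \<open>V\<close>.
\<close>

definition banach_subspace :: "'v::real_normed_vector set \<Rightarrow> bool" where
  "banach_subspace V \<longleftrightarrow> subspace V \<and> complete V"

definition bounded_operators ::
  "'v::real_normed_vector set \<Rightarrow> 'w::real_normed_vector set \<Rightarrow> ('v \<Rightarrow> 'w) set" where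
  "bounded_operators V W =
     {f \<in> V \<rightarrow>\<^sub>E W. (\<forall>u\<in>V. \<forall>v\<in>V. f (u + v) = f u + f v) \<and>
                  (\<forall>c. \<forall>v\<in>V. f (c *\<^sub>R v) = c *\<^sub>R f v) \<and>
                  (\<exists>K. \<forall>v\<in>V. norm (f v) \<le> norm v * K)}"

text \<open>This is \<^const>\<open>onorm\<close> relative to a subspace.\<close>

definition onorm_on ::
  "'v::real_normed_vector set \<Rightarrow> ('v \<Rightarrow> 'w::real_normed_vector) \<Rightarrow> real" where
  "onorm_on V f = (SUP v\<in>V. norm (f v) / norm v)"

definition dual_space :: "'v::real_normed_vector set \<Rightarrow> ('v \<Rightarrow> real) set" where
  "dual_space V = bounded_operators V UNIV"

text \<open>
  The distance \<open>\<parallel>\<phi> - \<psi>\<parallel>\<close> of the dual norm. The locale \<^locale>\<open>Metric_space\<close> asks for nonnegativity and symmetry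
  also off the carrier, whence the dummy value.
\<close>

definition dual_dist :: "'v::real_normed_vector set \<Rightarrow> ('v \<Rightarrow> real) \<Rightarrow> ('v \<Rightarrow> real) \<Rightarrow> real" where
  "dual_dist V \<phi> \<psi> =
     (if \<phi> \<in> dual_space V \<and> \<psi> \<in> dual_space V then onorm_on V (\<lambda>v. \<phi> v - \<psi> v) else 0)"

definition dual_norm_topology :: "'v::real_normed_vector set \<Rightarrow> ('v \<Rightarrow> real) topology" where
  "dual_norm_topology V = Metric_space.mtopology (dual_space V) (dual_dist V)"

definition dual_ball :: "'v::real_normed_vector set \<Rightarrow> ('v \<Rightarrow> real) set" where
  "dual_ball V = {\<phi> \<in> dual_space V. onorm_on V \<phi> \<le> 1}"

text \<open>The ball \<open>B(V\<^sup>*)\<close> with the weak-star topology, i.e. that of pointwise convergence on \<open>V\<close>.\<close>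

definition dual_ball_topology :: "'v::real_normed_vector set \<Rightarrow> ('v \<Rightarrow> real) topology" where
  "dual_ball_topology V = subtopology (product_topology (\<lambda>_. euclideanreal) V) (dual_ball V)"

definition asplund :: "'v::real_normed_vector set \<Rightarrow> bool" where
  "asplund V \<longleftrightarrow> banach_subspace V \<and>
     (\<forall>W. banach_subspace W \<and> W \<subseteq> V \<and> separable_space (top_of_set W) \<longrightarrow>
        separable_space (dual_norm_topology W))"

section \<open>Representations\<close>

definition contractions :: "'v::real_normed_vector set \<Rightarrow> ('v \<Rightarrow> 'v) set" where
  "contractions V = {\<sigma> \<in> bounded_operators V V. onorm_on V \<sigma> \<le> 1}"

text \<open>
  The weak operator topology on \<open>\<Theta>(V)\<close>: the initial topology for the maps
  \<open>\<sigma> \<mapsto> \<phi> (\<sigma> v)\<close> with \<open>v \<in> V\<close> and \<open>\<phi> \<in> V\<^sup>*\<close>.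
\<close>

definition weak_operator_topology :: "'v::real_normed_vector set \<Rightarrow> ('v \<Rightarrow> 'v) topology" where
  "weak_operator_topology V =
     pullback_topology (contractions V)
       (\<lambda>\<sigma>. \<lambda>(v, \<phi>) \<in> V \<times> dual_space V. \<phi> (\<sigma> v))
       (product_topology (\<lambda>_. euclideanreal) (V \<times> dual_space V))"

definition flow_representation ::
  "('g, 'm) monoid_scheme \<Rightarrow> 'g topology \<Rightarrow> 'x topology \<Rightarrow> ('g \<Rightarrow> 'x \<Rightarrow> 'x) \<Rightarrow>
   'v::real_normed_vector set \<Rightarrow> ('g \<Rightarrow> 'v \<Rightarrow> 'v) \<Rightarrow> ('x \<Rightarrow> 'v \<Rightarrow> real) \<Rightarrow> bool" where
  "flow_representation G TG X act V h \<alpha> \<longleftrightarrow>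
     continuous_map TG (weak_operator_topology V) h \<and>
     h \<one>\<^bsub>G\<^esub> = (\<lambda>v\<in>V. v) \<and>
     (\<forall>s\<in>carrier G. \<forall>t\<in>carrier G. h (s \<otimes>\<^bsub>G\<^esub> t) = compose V (h t) (h s)) \<and>
     continuous_map X (dual_ball_topology V) \<alpha> \<and>
     (\<forall>g\<in>carrier G. \<forall>x\<in>topspace X. \<forall>v\<in>V. \<alpha> (act g x) v = \<alpha> x (h g v))"

text \<open>
  The type arguments \<open>'i\<close> and \<open>'v\<close> supply the indices and the vectors of the family; they cannot be
  quantified inside a definition.
\<close>

definition RN_approximable ::
  "'i itself \<Rightarrow> 'v::real_normed_vector itself \<Rightarrow>
   ('g, 'm) monoid_scheme \<Rightarrow> 'g topology \<Rightarrow> 'x topology \<Rightarrow> ('g \<Rightarrow> 'x \<Rightarrow> 'x) \<Rightarrow> bool" where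
  "RN_approximable _ _ G TG X act \<longleftrightarrow>
     (\<exists>(I :: 'i set) (V :: 'i \<Rightarrow> 'v set) h \<alpha>.
        (\<forall>i\<in>I. asplund (V i) \<and> flow_representation G TG X act (V i) (h i) (\<alpha> i)) \<and>
        (\<forall>x\<in>topspace X. \<forall>y\<in>topspace X. x \<noteq> y \<longrightarrow> (\<exists>i\<in>I. \<alpha> i x \<noteq> \<alpha> i y)) \<and>
        (\<forall>F. closedin X F \<longrightarrow> (\<forall>x\<in>topspace X - F.
           \<exists>i\<in>I. \<alpha> i x \<notin> dual_ball_topology (V i) closure_of (\<alpha> i ` F))))"

section \<open>Sanity checks\<close>

lemma bdd_above_onorm_on:
  assumes "f \<in> bounded_operators V W"
  shows "bdd_above ((\<lambda>v. norm (f v) / norm v) ` V)"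
proof -
  obtain K where K: "\<And>v. v \<in> V \<Longrightarrow> norm (f v) \<le> norm v * K"
    using assms unfolding bounded_operators_def by blast
  have "norm (f v) / norm v \<le> max K 0" if "v \<in> V" for v
  proof (cases "v = 0")
    case False
    then have "norm (f v) / norm v \<le> K"
      using K[OF that] by (simp add: divide_le_eq mult.commute)
    then show ?thesis by simp
  qed simp
  then show ?thesis by (rule bdd_aboveI2)
qed

lemma onorm_on_le_1_iff:
  assumes "f \<in> bounded_operators V W" "subspace V"
  shows "onorm_on V f \<le> 1 \<longleftrightarrow> (\<forall>v\<in>V. norm (f v) \<le> norm v)"
proof -
  have ne: "V \<noteq> {}" using subspace_0[OF assms(2)] by blast
  have z: "norm (f 0) = 0"
    using assms subspace_0[OF assms(2)] unfolding bounded_operators_def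
    by (metis (mono_tags, lifting) mem_Collect_eq norm_zero scaleR_zero_left)
  have "onorm_on V f \<le> 1 \<longleftrightarrow> (\<forall>v\<in>V. norm (f v) / norm v \<le> 1)"
    unfolding onorm_on_def using cSUP_le_iff[OF ne bdd_above_onorm_on[OF assms(1)]] .
  also have "\<dots> \<longleftrightarrow> (\<forall>v\<in>V. norm (f v) \<le> norm v)"
    using z by (intro ball_cong refl) (auto simp: divide_le_eq)
  finally show ?thesis .
qed

lemma dual_space_diff:
  assumes "\<phi> \<in> dual_space V" "\<psi> \<in> dual_space V" "subspace V"
  shows "(\<lambda>v\<in>V. \<phi> v - \<psi> v) \<in> dual_space V"
proof -
  obtain K where K: "\<And>v. v \<in> V \<Longrightarrow> norm (\<phi> v) \<le> norm v * K"
    using assms(1) unfolding dual_space_def bounded_operators_def by blast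
  obtain L where L: "\<And>v. v \<in> V \<Longrightarrow> norm (\<psi> v) \<le> norm v * L"
    using assms(2) unfolding dual_space_def bounded_operators_def by blast
  have "norm (\<phi> v - \<psi> v) \<le> norm v * (K + L)" if "v \<in> V" for v
    using K[OF that] L[OF that] norm_triangle_ineq4[of "\<phi> v" "\<psi> v"] by (simp add: distrib_left)
  then have "\<exists>M. \<forall>v\<in>V. norm (\<phi> v - \<psi> v) \<le> norm v * M" by blast
  then show ?thesis
    using assms unfolding dual_space_def bounded_operators_def
    by (simp add: subspace_add subspace_scale PiE_iff right_diff_distrib)
qed

lemma dual_metric:
  assumes "subspace V"
  shows "Metric_space (dual_space V) (dual_dist V)"
proof
  have ne: "V \<noteq> {}" using subspace_0[OF assms] by blast
  have bdd: "bdd_above ((\<lambda>v. norm (\<phi> v - \<psi> v) / norm v) ` V)"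
    if "\<phi> \<in> dual_space V" "\<psi> \<in> dual_space V" for \<phi> \<psi>
  proof -
    have "bdd_above ((\<lambda>v. norm ((\<lambda>v\<in>V. \<phi> v - \<psi> v) v) / norm v) ` V)"
      by (rule bdd_above_onorm_on[OF dual_space_diff[OF that assms, unfolded dual_space_def]])
    then show ?thesis by (simp cong: image_cong_simp)
  qed
  have upper: "norm (\<phi> v - \<psi> v) / norm v \<le> dual_dist V \<phi> \<psi>"
    if "\<phi> \<in> dual_space V" "\<psi> \<in> dual_space V" "v \<in> V" for \<phi> \<psi> v
    using cSUP_upper[OF that(3) bdd[OF that(1,2)]] that unfolding dual_dist_def onorm_on_def by simp
  show "dual_dist V \<phi> \<psi> = dual_dist V \<psi> \<phi>" for \<phi> \<psi>
    by (simp add: dual_dist_def onorm_on_def abs_minus_commute)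
  show "dual_dist V \<phi> \<xi> \<le> dual_dist V \<phi> \<psi> + dual_dist V \<psi> \<xi>"
    if "\<phi> \<in> dual_space V" "\<psi> \<in> dual_space V" "\<xi> \<in> dual_space V" for \<phi> \<psi> \<xi>
  proof -
    have "norm (\<phi> v - \<xi> v) / norm v \<le> dual_dist V \<phi> \<psi> + dual_dist V \<psi> \<xi>" if "v \<in> V" for v
    proof -
      have "norm (\<phi> v - \<xi> v) / norm v \<le> norm (\<phi> v - \<psi> v) / norm v + norm (\<psi> v - \<xi> v) / norm v"
        unfolding add_divide_distrib[symmetric] by (intro divide_right_mono) auto
      then show ?thesis
        using upper[OF \<open>\<phi> \<in> _\<close> \<open>\<psi> \<in> _\<close> that] upper[OF \<open>\<psi> \<in> _\<close> \<open>\<xi> \<in> _\<close> that] by linarith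
    qed
    then show ?thesis
      using that unfolding dual_dist_def[of V \<phi> \<xi>] onorm_on_def by (simp add: cSUP_least[OF ne])
  qed
  show "dual_dist V \<phi> \<psi> = 0 \<longleftrightarrow> \<phi> = \<psi>"
    if dual: "\<phi> \<in> dual_space V" "\<psi> \<in> dual_space V" for \<phi> \<psi>
  proof
    assume 0: "dual_dist V \<phi> \<psi> = 0"
    have "\<phi> v = \<psi> v" if v: "v \<in> V" for v
    proof (cases "v = 0")
      case True
      have "\<phi> (0 *\<^sub>R v) = 0 *\<^sub>R \<phi> v" "\<psi> (0 *\<^sub>R v) = 0 *\<^sub>R \<psi> v"
        using \<open>\<phi> \<in> _\<close> \<open>\<psi> \<in> _\<close> v unfolding dual_space_def bounded_operators_def by blast+
      then show ?thesis using True by simp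
    next
      case False
      then have "norm (\<phi> v - \<psi> v) \<le> 0"
        using upper[OF dual v] 0 by (simp add: divide_le_0_iff)
      then show ?thesis by simp
    qed
    moreover have "\<phi> \<in> extensional V" "\<psi> \<in> extensional V"
      using dual unfolding dual_space_def bounded_operators_def PiE_def by blast+
    ultimately show "\<phi> = \<psi>" by (blast intro: extensionalityI)
  qed (simp add: dual_dist_def onorm_on_def ne)
  show "0 \<le> dual_dist V \<phi> \<psi>" for \<phi> \<psi>
  proof (cases "\<phi> \<in> dual_space V \<and> \<psi> \<in> dual_space V")
    case True
    then show ?thesis using upper[of \<phi> \<psi> 0] subspace_0[OF assms] by simp
  next
    case False
    then show ?thesis unfolding dual_dist_def by auto
  qed
qed

end

theory Submission
  imports Defs
begin

text \<open>
  Bounded subsets of the dual of an Asplund space are weak-star fragmented: otherwise a Cantor tree of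
  weak-star open sets, split by countably many vectors, would give uncountably many uniformly
  separated functionals on a separable subspace. Applied to the image of an orbit, fragmentation
  yields a relatively open set on which \<open>\<alpha>\<close> has small norm oscillation; a translate of it is a
  neighbourhood of the base point, and since the operators \<open>h g\<close> are contractions, the small norm
  oscillation is uniform over the group.
\<close>

section \<open>Weak uniformities\<close>

text \<open>A representation controls one evaluation \<open>\<lambda>x. \<alpha> i x v\<close> at a
  time, with a neighbourhood depending on \<open>i\<close> and \<open>v\<close>. The uniformity is
  therefore the weak one generated by all these evaluations: an entourage involves only finitely
  many of them, so finitely many neighbourhoods can be intersected. Separation of points from closed
  sets is what makes it induce the topology of \<open>X\<close>, and this single uniformity serves
  all orbit closures at once. The restriction to orbit closures comes from the translation step.
  Fragmentation gives no control over where the set of small oscillation lies; inside the closure of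
  the orbit of \<open>z\<close>, however, every nonempty relatively open set meets the orbit itself,
  so some group element carries \<open>z\<close> into it. In a quasiminimal subspace the orbit
  closure of a point contains a relative neighbourhood of that point, and the restriction
  disappears.\<close>

definition weak_uniformity :: "'x set \<Rightarrow> ('x \<Rightarrow> real) set \<Rightarrow> ('x \<times> 'x) filter" where
  "weak_uniformity S P =
     (INF (Q, e)\<in>{Q. finite Q \<and> Q \<subseteq> P} \<times> {0<..}.
        principal {(x, y). x \<in> S \<and> y \<in> S \<and> (\<forall>p\<in>Q. \<bar>p x - p y\<bar> < e)})"

text \<open>The basic entourages are directed downwards: take the union of the finite sets and the
  minimum of the radii. An infimum over a directed family is decided by one member. The pairs with
  \<open>Q = {}\<close> keep the index set nonempty for empty \<open>P\<close>, when the filter is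
  \<open>principal (S \<times> S)\<close>.\<close>

lemma eventually_weak_uniformity:
  "eventually E (weak_uniformity S P) \<longleftrightarrow>
     (\<exists>Q e. finite Q \<and> Q \<subseteq> P \<and> e > 0 \<and>
        (\<forall>x\<in>S. \<forall>y\<in>S. (\<forall>p\<in>Q. \<bar>p x - p y\<bar> < e) \<longrightarrow> E (x, y)))"
proof -
  let ?B = "{Q. finite Q \<and> Q \<subseteq> P} \<times> {0::real<..}"
  let ?F = "\<lambda>(Q, e::real). principal {(x, y). x \<in> S \<and> y \<in> S \<and> (\<forall>p\<in>Q. \<bar>p x - p y\<bar> < e)}"
  have "eventually E (weak_uniformity S P) \<longleftrightarrow> (\<exists>b\<in>?B. eventually E (?F b))"
    unfolding weak_uniformity_def
  proof (rule eventually_INF_base)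
    show "?B \<noteq> {}" by (auto intro!: exI[of _ "{}"] exI[of _ 1])
    fix a b assume "a \<in> ?B" "b \<in> ?B"
    then obtain Q R d e where ab: "a = (Q, d)" "b = (R, e)" and "finite Q" "finite R" "Q \<subseteq> P" "R \<subseteq> P"
      "d > 0" "e > 0" by auto
    then have "(Q \<union> R, min d e) \<in> ?B" by auto
    moreover have "?F (Q \<union> R, min d e) \<le> inf (?F a) (?F b)"
      unfolding ab by (auto simp: principal_le_iff)
    ultimately show "\<exists>x\<in>?B. ?F x \<le> inf (?F a) (?F b)" by blast
  qed
  also have "\<dots> \<longleftrightarrow> (\<exists>Q e. finite Q \<and> Q \<subseteq> P \<and> e > 0 \<and>
        (\<forall>x\<in>S. \<forall>y\<in>S. (\<forall>p\<in>Q. \<bar>p x - p y\<bar> < e) \<longrightarrow> E (x, y)))"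
    by (simp add: Bex_def Ball_def eventually_principal imp_conjL conj_ac)
  finally show ?thesis .
qed

text \<open>Lets the same functions \<open>P\<close> generate the uniformity on \<open>X\<close> and
  on each orbit closure, so that equicontinuity can be checked there function by function.\<close>

lemma uniformity_restrict_weak:
  assumes "T \<subseteq> S"
  shows "uniformity_restrict (weak_uniformity S P) T = weak_uniformity T P"
proof -
  have *: "(\<forall>x\<in>S. \<forall>y\<in>S. D x y \<longrightarrow> (x, y) \<in> T \<times> T \<longrightarrow> E x y) \<longleftrightarrow> (\<forall>x\<in>T. \<forall>y\<in>T. D x y \<longrightarrow> E x y)"
    for D E
    using assms by auto
  show ?thesis
    unfolding uniformity_restrict_def filter_eq_iff eventually_inf_principal eventually_weak_uniformity
    by (simp only: * simp_thms)
qed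

lemma uniformity_on_weak: "uniformity_on S (weak_uniformity S P)"
  unfolding uniformity_on_def
proof (intro conjI allI impI)
  show "weak_uniformity S P \<le> principal (S \<times> S)"
    unfolding le_principal eventually_weak_uniformity
    by (rule exI[of _ "{}"], rule exI[of _ 1]) simp
  fix E assume "eventually E (weak_uniformity S P)"
  then obtain Q e where Q: "finite Q" "Q \<subseteq> P" "e > 0"
    and E: "\<And>x y. x \<in> S \<Longrightarrow> y \<in> S \<Longrightarrow> (\<forall>p\<in>Q. \<bar>p x - p y\<bar> < e) \<Longrightarrow> E (x, y)"
    unfolding eventually_weak_uniformity by blast
  show "\<forall>x\<in>S. E (x, x)" using E Q(3) by auto
  have "E (y, x)" if "x \<in> S" "y \<in> S" "\<forall>p\<in>Q. \<bar>p x - p y\<bar> < e" for x y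
    using E[of y x] that by (auto simp: abs_minus_commute)
  then show "eventually (\<lambda>(x, y). E (y, x)) (weak_uniformity S P)"
    unfolding eventually_weak_uniformity using Q by blast
  let ?D = "\<lambda>(x, y). \<forall>p\<in>Q. \<bar>p x - p y\<bar> < e / 2"
  have "eventually ?D (weak_uniformity S P)"
    unfolding eventually_weak_uniformity
    using Q by (intro exI[of _ Q] exI[of _ "e/2"]) auto
  moreover have "E (x, z)" if "x \<in> S" "y \<in> S" "z \<in> S" "?D (x, y)" "?D (y, z)" for x y z
  proof (rule E)
    have "\<bar>p x - p z\<bar> < e" if "p \<in> Q" for p
    proof -
      have "\<bar>p x - p y\<bar> < e / 2" "\<bar>p y - p z\<bar> < e / 2"
        using \<open>?D (x, y)\<close> \<open>?D (y, z)\<close> that by auto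
      then show ?thesis by linarith
    qed
    then show "\<forall>p\<in>Q. \<bar>p x - p z\<bar> < e" by blast
  qed (use that in auto)
  ultimately show "\<exists>D. eventually D (weak_uniformity S P) \<and>
      (\<forall>x\<in>S. \<forall>y\<in>S. \<forall>z\<in>S. D (x, y) \<longrightarrow> D (y, z) \<longrightarrow> E (x, z))" by blast
qed

text \<open>The two hypotheses give the two inclusions: \<open>sep\<close>, applied to the
  complement of an open set, makes it open for the uniformity, and continuity of the members of
  \<open>P\<close> makes basic uniform neighbourhoods open in \<open>X\<close>.\<close>

lemma compatible_weak_uniformity:
  assumes cont: "\<And>p. p \<in> P \<Longrightarrow> continuous_map X euclideanreal p"
    and sep: "\<And>F x. closedin X F \<Longrightarrow> x \<in> topspace X \<Longrightarrow> x \<notin> F \<Longrightarrow>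
      \<exists>Q e. finite Q \<and> Q \<subseteq> P \<and> e > 0 \<and> (\<forall>y\<in>F. \<exists>p\<in>Q. e \<le> \<bar>p x - p y\<bar>)"
  shows "compatible_uniformity X (weak_uniformity (topspace X) P)"
  unfolding compatible_uniformity_def
proof (rule conjI[OF uniformity_on_weak], intro allI iffI)
  fix U assume U: "openin X U"
  have "\<exists>Q e. finite Q \<and> Q \<subseteq> P \<and> e > 0 \<and>
      (\<forall>a\<in>topspace X. \<forall>y\<in>topspace X. (\<forall>p\<in>Q. \<bar>p a - p y\<bar> < e) \<longrightarrow> a = x \<longrightarrow> y \<in> U)" if x: "x \<in> U" for x
  proof -
    have "closedin X (topspace X - U)" "x \<in> topspace X" "x \<notin> topspace X - U"
      using U x openin_subset by auto
    then obtain Q e where "finite Q" "Q \<subseteq> P" "e > 0"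
      and *: "\<forall>y\<in>topspace X - U. \<exists>p\<in>Q. e \<le> \<bar>p x - p y\<bar>"
      using sep by meson
    moreover have "\<forall>a\<in>topspace X. \<forall>y\<in>topspace X. (\<forall>p\<in>Q. \<bar>p a - p y\<bar> < e) \<longrightarrow> a = x \<longrightarrow> y \<in> U"
      using * by (metis DiffI linorder_not_less)
    ultimately show ?thesis by blast
  qed
  then show "U \<subseteq> topspace X \<and>
      (\<forall>x\<in>U. \<forall>\<^sub>F (x', y) in weak_uniformity (topspace X) P. x' = x \<longrightarrow> y \<in> U)"
    using openin_subset[OF U] unfolding eventually_weak_uniformity by auto
next
  fix U assume U: "U \<subseteq> topspace X \<and>
      (\<forall>x\<in>U. \<forall>\<^sub>F (x', y) in weak_uniformity (topspace X) P. x' = x \<longrightarrow> y \<in> U)"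
  show "openin X U"
  proof (subst openin_subopen, intro ballI)
    fix x assume x: "x \<in> U"
    then obtain Q e where Q: "finite Q" "Q \<subseteq> P" "e > 0"
      and sub: "\<forall>a\<in>topspace X. \<forall>y\<in>topspace X. (\<forall>p\<in>Q. \<bar>p a - p y\<bar> < e) \<longrightarrow> a = x \<longrightarrow> y \<in> U"
      using U unfolding eventually_weak_uniformity by (auto split: prod.splits)
    let ?T = "topspace X \<inter> (\<Inter>p\<in>Q. {y \<in> topspace X. p y \<in> ball (p x) e})"
    have "openin X ?T"
    \<comment> \<open>For empty \<open>Q\<close> the inner intersection is \<open>UNIV\<close>; the
      factor \<open>topspace X\<close> in \<open>?T\<close> covers that case.\<close>
    proof (cases "Q = {}")
      case False
      have "openin X {y \<in> topspace X. p y \<in> ball (p x) e}" if "p \<in> Q" for p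
        by (rule openin_continuous_map_preimage[OF cont]) (use that Q in auto)
      then show ?thesis using False Q by (intro openin_Int openin_INT openin_topspace) auto
    qed simp
    moreover have "x \<in> ?T" using x U Q by auto
    moreover have "?T \<subseteq> U" using sub x U by (auto simp: dist_real_def)
    ultimately show "\<exists>T. openin X T \<and> x \<in> T \<and> T \<subseteq> U" by blast
  qed
qed

lemma equicontinuity_point_weak_uniformity:
  assumes z: "z \<in> topspace Y"
    and inv: "\<And>g x. g \<in> carrier G \<Longrightarrow> x \<in> topspace Y \<Longrightarrow> act g x \<in> topspace Y"
    and eq: "\<And>p e. p \<in> P \<Longrightarrow> e > 0 \<Longrightarrow> \<exists>U. openin Y U \<and> z \<in> U \<and>
      (\<forall>x\<in>U. \<forall>g\<in>carrier G. \<bar>p (act g x) - p (act g z)\<bar> < e)"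
  shows "equicontinuity_point G Y act (weak_uniformity (topspace Y) P) z"
  unfolding equicontinuity_point_def
proof (intro allI impI)
  fix E assume "eventually E (weak_uniformity (topspace Y) P)"
  then obtain Q e where Q: "finite Q" "Q \<subseteq> P" "e > 0"
    and E: "\<forall>x\<in>topspace Y. \<forall>y\<in>topspace Y. (\<forall>p\<in>Q. \<bar>p x - p y\<bar> < e) \<longrightarrow> E (x, y)"
    unfolding eventually_weak_uniformity by blast
  have "\<forall>p\<in>Q. \<exists>U. openin Y U \<and> z \<in> U \<and> (\<forall>x\<in>U. \<forall>g\<in>carrier G. \<bar>p (act g x) - p (act g z)\<bar> < e)"
    using eq Q by blast
  then obtain U where U: "\<forall>p\<in>Q. openin Y (U p) \<and> z \<in> U p \<and>
      (\<forall>x\<in>U p. \<forall>g\<in>carrier G. \<bar>p (act g x) - p (act g z)\<bar> < e)"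
    by metis
  let ?T = "topspace Y \<inter> (\<Inter>p\<in>Q. U p)"
  have "openin Y ?T"
    using U Q by (cases "Q = {}") (auto intro!: openin_Int openin_INT)
  moreover have "z \<in> ?T" using z U by auto
  moreover have "E (act g x, act g z)" if "x \<in> ?T" "g \<in> carrier G" for x g
    using E inv[OF that(2)] z U that by auto
  ultimately show "\<exists>U. openin Y U \<and> z \<in> U \<and> (\<forall>x\<in>U. \<forall>g\<in>carrier G. E (act g x, act g z))"
    by blast
qed

section \<open>The dual ball\<close>

lemma dual_ballI:
  assumes "subspace V" "f \<in> extensional V"
    and "\<And>u v. u \<in> V \<Longrightarrow> v \<in> V \<Longrightarrow> f (u + v) = f u + f v"
    and "\<And>c v. v \<in> V \<Longrightarrow> f (c *\<^sub>R v) = c * f v"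
    and "\<And>v. v \<in> V \<Longrightarrow> \<bar>f v\<bar> \<le> norm v"
  shows "f \<in> dual_ball V"
proof -
  have "\<exists>K. \<forall>v\<in>V. norm (f v) \<le> norm v * K"
    using assms(5) by (intro exI[of _ 1]) auto
  then have "f \<in> bounded_operators V UNIV"
    unfolding bounded_operators_def using assms by (auto simp: PiE_def)
  then show ?thesis
    unfolding dual_ball_def dual_space_def using assms by (auto simp: onorm_on_le_1_iff)
qed

lemma dual_ballD:
  assumes "f \<in> dual_ball V" "subspace V"
  shows "f \<in> extensional V"
    and "\<And>u v. u \<in> V \<Longrightarrow> v \<in> V \<Longrightarrow> f (u + v) = f u + f v"
    and "\<And>c v. v \<in> V \<Longrightarrow> f (c *\<^sub>R v) = c * f v"
    and "\<And>v. v \<in> V \<Longrightarrow> \<bar>f v\<bar> \<le> norm v"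
proof -
  have f: "f \<in> bounded_operators V UNIV" "onorm_on V f \<le> 1"
    using assms unfolding dual_ball_def dual_space_def by auto
  then show "\<And>v. v \<in> V \<Longrightarrow> \<bar>f v\<bar> \<le> norm v"
    using onorm_on_le_1_iff assms(2) by (metis real_norm_def)
qed (use assms in \<open>auto simp: dual_ball_def dual_space_def bounded_operators_def PiE_def\<close>)

lemma topspace_dual_ball_topology: "topspace (dual_ball_topology V) = dual_ball V"
  unfolding dual_ball_topology_def
  by (auto simp: dual_ball_def dual_space_def bounded_operators_def)

lemma continuous_map_dual_ball_eval:
  "v \<in> V \<Longrightarrow> continuous_map (dual_ball_topology V) euclideanreal (\<lambda>f. f v)"
  unfolding dual_ball_topology_def
  by (intro continuous_map_from_subtopology continuous_map_product_projection)

text \<open>This is the Banach-Alaoglu theorem: the ball is the part of a product of compact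
  intervals, \<open>?K\<close>, cut out by the linearity equations, \<open>?L\<close>, each of which
  is a closed condition on finitely many coordinates.\<close>

lemma compact_space_dual_ball:
  assumes "subspace V"
  shows "compact_space (dual_ball_topology V)"
proof -
  let ?P = "product_topology (\<lambda>_. euclideanreal) V"
  let ?K = "PiE V (\<lambda>v. {- norm v..norm v})"
  let ?add = "\<lambda>u v. {f \<in> topspace ?P. f (u + v) - (f u + f v) \<in> {0}}"
  let ?scale = "\<lambda>c v. {f \<in> topspace ?P. f (c *\<^sub>R v) - c * f v \<in> {0}}"
  let ?L = "topspace ?P \<inter> (\<Inter>u\<in>V. \<Inter>v\<in>V. ?add u v) \<inter> (\<Inter>c. \<Inter>v\<in>V. ?scale c v)"
  have ne: "V \<noteq> {}" using subspace_0[OF assms] by blast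
  have proj: "continuous_map ?P euclideanreal (\<lambda>f. f v)" if "v \<in> V" for v
    using that by (rule continuous_map_product_projection)
  have add: "closedin ?P (?add u v)" if "u \<in> V" "v \<in> V" for u v
    by (rule closedin_continuous_map_preimage[of _ euclideanreal])
       (use that assms in \<open>auto intro!: continuous_map_diff continuous_map_add proj subspace_add\<close>)
  have scale: "closedin ?P (?scale c v)" if "v \<in> V" for c v
    by (rule closedin_continuous_map_preimage[of _ euclideanreal])
       (use that assms in \<open>auto intro!: continuous_map_diff continuous_map_real_mult_left proj subspace_scale\<close>)
  have "closedin ?P ?L"
    using add scale ne by (intro closedin_Int closedin_INT closedin_topspace) auto
  moreover have "compactin ?P ?K" by (simp add: compactin_PiE)
  ultimately have "compactin ?P (?L \<inter> ?K)" by (rule closed_Int_compactin)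
  moreover have "?L \<inter> ?K = dual_ball V"
  proof (intro equalityI subsetI)
    fix f assume f: "f \<in> ?L \<inter> ?K"
    show "f \<in> dual_ball V"
    proof (rule dual_ballI[OF assms])
      show "f \<in> extensional V" using f by (auto simp: PiE_def)
      show "f (u + v) = f u + f v" if "u \<in> V" "v \<in> V" for u v using f that by auto
      show "f (c *\<^sub>R v) = c * f v" if "v \<in> V" for c v using f that by auto
      show "\<bar>f v\<bar> \<le> norm v" if "v \<in> V" for v
        using f that by (auto simp: PiE_def Pi_def abs_le_iff)
    qed
  next
    fix f assume "f \<in> dual_ball V"
    note f = dual_ballD[OF this assms]
    have "f v \<in> {- norm v..norm v}" if "v \<in> V" for v using f(4)[OF that] by auto
    then have "f \<in> ?K" using f(1) by (auto simp: PiE_def)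
    moreover have "f \<in> ?L" using f by (auto simp: PiE_def)
    ultimately show "f \<in> ?L \<inter> ?K" by blast
  qed
  ultimately show ?thesis
    unfolding dual_ball_topology_def by (simp add: compact_space_subtopology)
qed

lemma dual_ball_nbhd:
  assumes "openin (dual_ball_topology V) T" "f \<in> T"
  obtains Q e where "finite Q" "Q \<subseteq> V" "e > 0"
    "\<And>g. g \<in> dual_ball V \<Longrightarrow> (\<And>v. v \<in> Q \<Longrightarrow> \<bar>f v - g v\<bar> < e) \<Longrightarrow> g \<in> T"
proof -
  obtain S where S: "openin (product_topology (\<lambda>_. euclideanreal) V) S" "T = S \<inter> dual_ball V"
    using assms unfolding dual_ball_topology_def openin_subtopology by blast
  then obtain U where U: "finite {v \<in> V. U v \<noteq> UNIV}" "\<forall>v\<in>V. open (U v)" "f \<in> PiE V U" "PiE V U \<subseteq> S"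
    using assms(2) unfolding openin_product_topology_alt by auto
  let ?Q = "{v \<in> V. U v \<noteq> UNIV}"
  have "\<forall>v\<in>?Q. \<exists>d>0. ball (f v) d \<subseteq> U v"
    using U by (auto simp: PiE_def Pi_def open_contains_ball)
  then obtain d where d: "\<And>v. v \<in> ?Q \<Longrightarrow> d v > 0 \<and> ball (f v) (d v) \<subseteq> U v" by metis
  \<comment> \<open>The inserted \<open>1\<close> keeps the minimum meaningful when no coordinate is
    constrained.\<close>
  define e where "e = Min (insert 1 (d ` ?Q))"
  have "0 < x" if "x \<in> insert 1 (d ` ?Q)" for x using that
  proof
    assume "x \<in> d ` ?Q"
    then show ?thesis using d by blast
  qed simp
  then have "e > 0" unfolding e_def using U(1) by (subst Min_gr_iff) simp_all
  have ed: "e \<le> d v" if "v \<in> ?Q" for v unfolding e_def using U(1) that by (intro Min_le) auto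
  have "g \<in> T" if g: "g \<in> dual_ball V" "\<And>v. v \<in> ?Q \<Longrightarrow> \<bar>f v - g v\<bar> < e" for g
  proof -
    have "g v \<in> U v" if "v \<in> V" for v
    proof (cases "U v = UNIV")
      case False
      then have "g v \<in> ball (f v) (d v)" using g(2)[of v] ed[of v] that by (auto simp: dist_real_def)
      then show ?thesis using d[of v] False that by auto
    qed simp
    moreover have "g \<in> extensional V"
      using g(1) by (auto simp: dual_ball_def dual_space_def bounded_operators_def PiE_def)
    ultimately have "g \<in> PiE V U" by (auto simp: PiE_def)
    then show ?thesis using U S g by blast
  qed
  then show ?thesis using that[of ?Q e] U(1) \<open>e > 0\<close> by blast
qed

section \<open>Fragmentability of the dual of an Asplund space\<close>

text \<open>\<open>W\<close> is the closure of the rational linear span of \<open>D\<close>. It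
  brings the countably many vectors of the Cantor tree into a subspace to which the Asplund property
  applies.\<close>

lemma countable_subset_of_separable_banach_subspace:
  fixes D :: "'v::real_normed_vector set"
  assumes "banach_subspace V" "countable D" "D \<subseteq> V"
  obtains W where "banach_subspace W" "D \<subseteq> W" "W \<subseteq> V" "separable_space (top_of_set W)"
proof -
  \<comment> \<open>Coding rational combinations by lists makes the span visibly countable and turns
    addition into concatenation.\<close>
  define lc :: "(rat \<times> 'v) list \<Rightarrow> 'v" where
    "lc xs = sum_list (map (\<lambda>(q, d). of_rat q *\<^sub>R d) xs)" for xs
  define S where "S = lc ` lists (UNIV \<times> D)"
  have V: "subspace V" "complete V" using assms(1) unfolding banach_subspace_def by auto
  have "countable S" unfolding S_def using assms(2) by (intro countable_image countable_lists) auto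
  have Sadd: "x + y \<in> S" if xy: "x \<in> S" "y \<in> S" for x y
  proof -
    obtain xs ys where "x = lc xs" "y = lc ys" "xs \<in> lists (UNIV \<times> D)" "ys \<in> lists (UNIV \<times> D)"
      using xy unfolding S_def by blast
    then have "x + y = lc (xs @ ys)" "xs @ ys \<in> lists (UNIV \<times> D)" unfolding lc_def by auto
    then show ?thesis unfolding S_def by blast
  qed
  have lc_scale: "lc (map (\<lambda>(p, d). (q * p, d)) xs) = of_rat q *\<^sub>R lc xs" for q xs
    unfolding lc_def by (induction xs) (auto simp: scaleR_add_right of_rat_mult)
  have Sscale: "of_rat q *\<^sub>R x \<in> S" if x: "x \<in> S" for q x
  proof -
    obtain xs where xs: "x = lc xs" "xs \<in> lists (UNIV \<times> D)" using x unfolding S_def by blast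
    then have "map (\<lambda>(p, d). (q * p, d)) xs \<in> lists (UNIV \<times> D)"
      by (auto simp: in_lists_conv_set)
    then show ?thesis unfolding S_def xs(1) lc_scale[symmetric] by blast
  qed
  have "0 \<in> S" unfolding S_def by (rule image_eqI[of _ _ "[]"]) (auto simp: lc_def)
  have "D \<subseteq> S"
  proof
    fix d assume "d \<in> D"
    then show "d \<in> S" unfolding S_def by (intro image_eqI[of _ _ "[(1, d)]"]) (auto simp: lc_def)
  qed
  have "S \<subseteq> V"
  proof
    fix x assume "x \<in> S"
    then obtain xs where xs: "x = lc xs" "xs \<in> lists (UNIV \<times> D)" unfolding S_def by blast
    from xs(2) have "lc xs \<in> V"
      by (induction xs) (use assms(3) V(1) in \<open>auto simp: lc_def subspace_0 intro!: subspace_add subspace_scale\<close>)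
    then show "x \<in> V" using xs by simp
  qed
  have "closed V" using V(2) by (rule complete_imp_closed)
  then have "closure S \<subseteq> V" using \<open>S \<subseteq> V\<close> by (rule closure_minimal[rotated])
  have "subspace (closure S)"
    unfolding subspace_def
  proof (intro conjI ballI allI)
    show "0 \<in> closure S" using \<open>0 \<in> S\<close> closure_subset by blast
  next
    fix x y assume "x \<in> closure S" "y \<in> closure S"
    then obtain a b where "\<And>n. a n \<in> S" "a \<longlonglongrightarrow> x" "\<And>n. b n \<in> S" "b \<longlonglongrightarrow> y"
      unfolding closure_sequential by blast
    then show "x + y \<in> closure S"
      unfolding closure_sequential
      by (intro exI[of _ "\<lambda>n. a n + b n"]) (auto intro: Sadd tendsto_add)
  next
    fix c :: real and x assume "x \<in> closure S"
    then obtain a where a: "\<And>n. a n \<in> S" "a \<longlonglongrightarrow> x" unfolding closure_sequential by blast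
    \<comment> \<open>\<open>S\<close> is stable under rational scalars only; a real scalar is
      reached by approximating it along with the vector.\<close>
    have "\<exists>r. \<bar>of_rat r - c\<bar> < inverse (Suc n)" for n
      by (rule rational_approximation[of "inverse (Suc n)" c]) (auto elim!: Rats_cases)
    then obtain r where "\<And>n. \<bar>of_rat (r n) - c\<bar> < inverse (Suc n)" by metis
    then have "(\<lambda>n. of_rat (r n) - c) \<longlonglongrightarrow> 0"
      by (intro Lim_null_comparison[OF _ LIMSEQ_inverse_real_of_nat]) (auto intro!: always_eventually less_imp_le)
    then have r: "(\<lambda>n. of_rat (r n)) \<longlonglongrightarrow> c" by (rule Lim_null[THEN iffD2])
    show "c *\<^sub>R x \<in> closure S"
      unfolding closure_sequential using r a
      by (intro exI[of _ "\<lambda>n. of_rat (r n) *\<^sub>R a n"]) (auto intro: tendsto_scaleR Sscale)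
  qed
  moreover have "complete (closure S)"
    by (rule complete_closed_subset[OF closed_closure \<open>closure S \<subseteq> V\<close> V(2)])
  moreover have "separable_space (top_of_set (closure S))"
    unfolding separable_space_def
  proof (intro exI conjI)
    show "countable S" by fact
    show "S \<subseteq> topspace (top_of_set (closure S))" using closure_subset by simp
    show "top_of_set (closure S) closure_of S = topspace (top_of_set (closure S))"
      using closure_subset[of S] by (simp add: closure_of_subtopology Int_absorb1)
  qed
  ultimately show ?thesis
    using that[of "closure S"] \<open>closure S \<subseteq> V\<close> \<open>D \<subseteq> S\<close> closure_subset[of S]
    unfolding banach_subspace_def by blast
qed

lemma dual_dist_upper:
  assumes "subspace V" "\<phi> \<in> dual_space V" "\<psi> \<in> dual_space V" "v \<in> V"
  shows "\<bar>\<phi> v - \<psi> v\<bar> / norm v \<le> dual_dist V \<phi> \<psi>"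
proof -
  have "bdd_above ((\<lambda>v. norm ((\<lambda>v\<in>V. \<phi> v - \<psi> v) v) / norm v) ` V)"
    by (rule bdd_above_onorm_on[OF dual_space_diff[OF assms(2,3,1), unfolded dual_space_def]])
  then have "bdd_above ((\<lambda>v. norm (\<phi> v - \<psi> v) / norm v) ` V)"
    by (simp cong: image_cong_simp)
  from cSUP_upper[OF assms(4) this] show ?thesis
    using assms unfolding dual_dist_def onorm_on_def by simp
qed

text \<open>Two members of the family within \<open>d / 2\<close> of the same point of a countable
  dense set would be closer than \<open>d\<close>. Choosing a nearby dense point is therefore
  injective on the uncountable set of binary sequences.\<close>

lemma separable_dual_no_separated_cantor_set:
  fixes r :: "(nat \<Rightarrow> bool) \<Rightarrow> 'v::real_normed_vector \<Rightarrow> real"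
  assumes "subspace W" "separable_space (dual_norm_topology W)"
    and r: "\<And>\<sigma>. r \<sigma> \<in> dual_space W" and "d > 0"
    and sep: "\<And>\<sigma> \<tau>. \<sigma> \<noteq> \<tau> \<Longrightarrow> d \<le> dual_dist W (r \<sigma>) (r \<tau>)"
  shows False
proof -
  interpret Metric_space "dual_space W" "dual_dist W" using assms(1) by (rule dual_metric)
  obtain C where C: "countable C" "C \<subseteq> dual_space W" "mtopology closure_of C = dual_space W"
    using assms(2) unfolding separable_space_def dual_norm_topology_def by auto
  have "\<exists>c\<in>C. dual_dist W (r \<sigma>) c < d / 2" for \<sigma>
  proof -
    have "r \<sigma> \<in> mtopology closure_of C" using r C(3) by simp
    then obtain c where "c \<in> C" "c \<in> mball (r \<sigma>) (d / 2)"
      using \<open>d > 0\<close> unfolding metric_closure_of by (auto dest!: spec[of _ "d / 2"])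
    then show ?thesis by auto
  qed
  then obtain c where c: "\<And>\<sigma>. c \<sigma> \<in> C" "\<And>\<sigma>. dual_dist W (r \<sigma>) (c \<sigma>) < d / 2" by metis
  have "inj c"
  proof (rule injI, rule ccontr)
    fix \<sigma> \<tau> assume "c \<sigma> = c \<tau>" "\<sigma> \<noteq> \<tau>"
    have "dual_dist W (r \<sigma>) (r \<tau>) \<le> dual_dist W (r \<sigma>) (c \<sigma>) + dual_dist W (r \<tau>) (c \<sigma>)"
      using triangle[of "r \<sigma>" "c \<sigma>" "r \<tau>"] commute[of "c \<sigma>" "r \<tau>"] r c(1) C(2) by auto
    then show False
      using c(2)[of \<sigma>] c(2)[of \<tau>] sep[OF \<open>\<sigma> \<noteq> \<tau>\<close>] \<open>c \<sigma> = c \<tau>\<close> by simp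
  qed
  moreover have "countable (range c)" using c(1) by (intro countable_subset[OF _ C(1)]) auto
  ultimately have "countable (UNIV :: (nat \<Rightarrow> bool) set)" by (rule countable_image_inj_on[rotated])
  then obtain F :: "nat \<Rightarrow> nat \<Rightarrow> bool" where "range F = UNIV"
    by (metis UNIV_not_empty range_from_nat_into)
  \<comment> \<open>Cantor's diagonal sequence; evaluating it at \<open>n\<close> is
    contradictory.\<close>
  then obtain n where "F n = (\<lambda>k. \<not> F k k)" by (metis UNIV_I imageE)
  then show False by metis
qed

text \<open>\<open>A\<close> is arbitrary, not closed: compactness comes from the whole ball, and
  the limit functionals of the branches may lie outside \<open>A\<close>. This is harmless, since
  they are separated by values on vectors, which persist in weak-star closed sets.\<close>

lemma asplund_dual_ball_fragmented:
  fixes V :: "'v::real_normed_vector set"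
  assumes "asplund V" "A \<subseteq> dual_ball V" "A \<noteq> {}" "e > 0"
  shows "\<exists>U. openin (dual_ball_topology V) U \<and> U \<inter> A \<noteq> {} \<and>
    (\<forall>f\<in>U \<inter> A. \<forall>g\<in>U \<inter> A. \<forall>v\<in>V. \<bar>f v - g v\<bar> \<le> e * norm v)"
proof (rule ccontr)
  assume notfrag: "\<not> ?thesis"
  let ?T = "dual_ball_topology V"
  have V: "subspace V" and banV: "banach_subspace V"
    using assms(1) unfolding asplund_def banach_subspace_def by auto
  \<comment> \<open>The invariant of the tree nodes: closedness is for compactness along a branch,
    and the open set meeting \<open>A\<close> is what the failure of fragmentation splits
    again.\<close>
  define fat where "fat C \<longleftrightarrow> closedin ?T C \<and> (\<exists>N. openin ?T N \<and> N \<subseteq> C \<and> N \<inter> A \<noteq> {})" for C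
  define good where "good C v S \<longleftrightarrow> v \<in> V \<and> norm v = 1 \<and> (\<forall>b. fat (S b) \<and> S b \<subseteq> C) \<and>
      (\<forall>f\<in>S True. \<forall>g\<in>S False. e / 3 \<le> \<bar>f v - g v\<bar>)" for C v S
  have split: "\<exists>v S. good C v S" if C: "fat C" for C
  proof -
    obtain N where N: "closedin ?T C" "openin ?T N" "N \<subseteq> C" "N \<inter> A \<noteq> {}"
      using C unfolding fat_def by blast
    then obtain f g u where fg: "f \<in> N \<inter> A" "g \<in> N \<inter> A" "u \<in> V" "e * norm u < \<bar>f u - g u\<bar>"
      using notfrag by (meson linorder_not_less)
    have dual: "f \<in> dual_ball V" "g \<in> dual_ball V" using fg assms(2) by auto
    have "u \<noteq> 0"
    proof
      assume "u = 0"
      then have "f u = 0" "g u = 0" using dual_ballD(4)[OF _ V fg(3)] dual by fastforce+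
      then show False using fg(4) \<open>u = 0\<close> by simp
    qed
    \<comment> \<open>With norm one, a gap between values at \<open>v\<close> is directly a lower
      bound for the dual distance.\<close>
    define v where "v = (1 / norm u) *\<^sub>R u"
    have v: "v \<in> V" "norm v = 1" unfolding v_def using V fg(3) \<open>u \<noteq> 0\<close> by (auto simp: subspace_scale)
    have "f v - g v = (f u - g u) / norm u"
      unfolding v_def dual_ballD(3)[OF dual(1) V fg(3)] dual_ballD(3)[OF dual(2) V fg(3)]
      by (simp add: diff_divide_distrib)
    then have far: "e < \<bar>f v - g v\<bar>"
      using fg(4) \<open>u \<noteq> 0\<close> by (simp add: abs_divide pos_less_divide_eq)
    define h where "h b = (if b then f else g)" for b
    \<comment> \<open>The values \<open>f v\<close> and \<open>g v\<close> are more than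
      \<open>e\<close> apart, so radius \<open>e / 3\<close> around each leaves a gap of
      \<open>e / 3\<close>, the same at every level. The closed ball keeps the child closed; the
      open ball of equal radius supplies its open part.\<close>
    define S where "S b = C \<inter> {k \<in> topspace ?T. k v \<in> cball (h b v) (e / 3)}" for b
    have "fat (S b)" for b
      unfolding fat_def
    proof (intro conjI exI)
      show "closedin ?T (S b)" unfolding S_def
        by (intro closedin_Int N(1) closedin_continuous_map_preimage[OF continuous_map_dual_ball_eval[OF v(1)]]) simp
      let ?N = "N \<inter> {k \<in> topspace ?T. k v \<in> ball (h b v) (e / 3)}"
      show "openin ?T ?N"
        by (intro openin_Int N(2) openin_continuous_map_preimage[OF continuous_map_dual_ball_eval[OF v(1)]]) simp
      show "?N \<subseteq> S b" unfolding S_def using N(3) by auto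
      have "h b \<in> ?N \<inter> A"
        using fg dual \<open>e > 0\<close> by (auto simp: h_def topspace_dual_ball_topology)
      then show "?N \<inter> A \<noteq> {}" by blast
    qed
    moreover have "e / 3 \<le> \<bar>k v - l v\<bar>" if "k \<in> S True" "l \<in> S False" for k l
    proof -
      have "\<bar>f v - k v\<bar> \<le> e / 3" "\<bar>g v - l v\<bar> \<le> e / 3"
        using that unfolding S_def h_def by (auto simp: dist_real_def)
      then show ?thesis using far by linarith
    qed
    moreover have "S b \<subseteq> C" for b unfolding S_def by blast
    ultimately have "good C v S" unfolding good_def using v by simp
    then show ?thesis by blast
  qed
  have "\<forall>C. \<exists>v S. fat C \<longrightarrow> good C v S" using split by blast
  then obtain w step where "\<And>C. fat C \<Longrightarrow> good C (w C) (step C)" by metis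
  then have w: "w C \<in> V" "norm (w C) = 1"
    and step: "fat (step C b)" "step C b \<subseteq> C"
    and far: "f \<in> step C True \<Longrightarrow> g \<in> step C False \<Longrightarrow> e / 3 \<le> \<bar>f (w C) - g (w C)\<bar>"
    if "fat C" for C b f g
    using that unfolding good_def by blast+
  \<comment> \<open>Addresses are read from the end: the head of the list is the latest choice.
    Hence the \<open>rev\<close> in \<open>path\<close>, which makes
    \<open>path \<sigma> (Suc n)\<close> equal to
    \<open>\<sigma> n # path \<sigma> n\<close>.\<close>
  define node where "node = rec_list (dual_ball V) (\<lambda>b _ C. step C b)"
  have node_simps: "node [] = dual_ball V" "node (b # s) = step (node s) b" for b s
    unfolding node_def by simp_all
  have "fat (dual_ball V)"
    unfolding fat_def using assms(2,3)
    by (intro conjI exI[of _ "dual_ball V"])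
       (auto simp flip: topspace_dual_ball_topology)
  then have fat: "fat (node s)" for s
    by (induction s) (auto simp: node_simps step(1))
  define path where "path \<sigma> n = map \<sigma> (rev [0..<n])" for \<sigma> :: "nat \<Rightarrow> bool" and n
  have node_path: "node (path \<sigma> (Suc n)) = step (node (path \<sigma> n)) (\<sigma> n)" for \<sigma> n
    unfolding path_def by (simp add: node_simps)
  have nest: "(\<Inter>n. node (path \<sigma> n)) \<noteq> {}" for \<sigma>
  proof (rule compact_space_imp_nest[OF compact_space_dual_ball[OF V]])
    show "closedin ?T (node (path \<sigma> n))" for n using fat unfolding fat_def by blast
    show "node (path \<sigma> n) \<noteq> {}" for n using fat unfolding fat_def by blast
    show "decseq (\<lambda>n. node (path \<sigma> n))"
      by (rule decseq_SucI) (simp add: node_path step(2) fat)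
  qed
  have "\<exists>f. \<forall>n. f \<in> node (path \<sigma> n)" for \<sigma> using nest[of \<sigma>] by blast
  then obtain F where F: "\<And>\<sigma> n. F \<sigma> \<in> node (path \<sigma> n)" by metis
  have F_ball: "F \<sigma> \<in> dual_ball V" for \<sigma>
    using F[of \<sigma> 0] by (simp add: path_def node_simps)
  \<comment> \<open>There is one splitting vector per finite address, hence countably many for
    uncountably many branches.\<close>
  have "countable (range (\<lambda>s. w (node s)))" "range (\<lambda>s. w (node s)) \<subseteq> V"
    using w(1) fat by auto
  then obtain W where W: "banach_subspace W" "range (\<lambda>s. w (node s)) \<subseteq> W" "W \<subseteq> V"
    "separable_space (top_of_set W)"
    using countable_subset_of_separable_banach_subspace[OF banV] by blast
  have subW: "subspace W" using W(1) unfolding banach_subspace_def by blast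
  define r where "r \<sigma> = restrict (F \<sigma>) W" for \<sigma>
  have "r \<sigma> \<in> dual_ball W" for \<sigma>
    unfolding r_def using dual_ballD[OF F_ball[of \<sigma>] V] W(3) subW
    by (intro dual_ballI) (auto simp: subspace_add subspace_scale subset_iff)
  then have r: "r \<sigma> \<in> dual_space W" for \<sigma> unfolding dual_ball_def by blast
  have separated: "e / 3 \<le> dual_dist W (r \<sigma>) (r \<tau>)" if "\<sigma> \<noteq> \<tau>" for \<sigma> \<tau>
  proof -
    \<comment> \<open>Up to the first difference both branches pass through the same node, whose
      splitting vector then separates their limits.\<close>
    define n where "n = (LEAST n. \<sigma> n \<noteq> \<tau> n)"
    have "\<exists>n. \<sigma> n \<noteq> \<tau> n" using that by auto
    then have n: "\<sigma> n \<noteq> \<tau> n" unfolding n_def by (rule LeastI_ex)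
    have "\<sigma> k = \<tau> k" if "k < n" for k using not_less_Least that unfolding n_def by blast
    then have "path \<sigma> n = path \<tau> n" unfolding path_def by simp
    then obtain s where s: "node (path \<sigma> (Suc n)) = step (node s) (\<sigma> n)"
      "node (path \<tau> (Suc n)) = step (node s) (\<tau> n)"
      using node_path by metis
    have "F \<sigma> \<in> step (node s) (\<sigma> n)" "F \<tau> \<in> step (node s) (\<tau> n)"
      using F[of \<sigma> "Suc n"] F[of \<tau> "Suc n"] s by auto
    then have "e / 3 \<le> \<bar>F \<sigma> (w (node s)) - F \<tau> (w (node s))\<bar>"
      using n far[OF fat[of s], of "F \<sigma>" "F \<tau>"] far[OF fat[of s], of "F \<tau>" "F \<sigma>"]
      by (cases "\<sigma> n") (auto simp: abs_minus_commute)
    moreover have "w (node s) \<in> W" using W(2) by blast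
    ultimately show ?thesis
      using dual_dist_upper[OF subW r r, of "w (node s)" \<sigma> \<tau>] w(2)[OF fat[of s]]
      unfolding r_def by simp
  qed
  have "separable_space (dual_norm_topology W)"
    using assms(1) W unfolding asplund_def by blast
  then show False
    by (rule separable_dual_no_separated_cantor_set[OF subW _ r _ separated]) (use \<open>e > 0\<close> in simp)
qed

section \<open>Equicontinuity on orbit closures\<close>

context semitopological_flow
begin

lemma act_closed: "g \<in> carrier G \<Longrightarrow> x \<in> topspace X \<Longrightarrow> act g x \<in> topspace X"
  using act_continuous_space continuous_map_image_subset_topspace by fastforce

lemma orbit_subset: "z \<in> topspace X \<Longrightarrow> orbit G act z \<subseteq> topspace X"
  unfolding orbit_def using act_closed by auto

lemma orbit_self: "z \<in> topspace X \<Longrightarrow> z \<in> orbit G act z"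
  unfolding orbit_def using act_one by force

lemma orbit_invariant:
  assumes "z \<in> topspace X" "g \<in> carrier G" "x \<in> orbit G act z"
  shows "act g x \<in> orbit G act z"
proof -
  obtain k where "k \<in> carrier G" "x = act k z" using assms(3) unfolding orbit_def by auto
  then have "act g x = act (g \<otimes> k) z" "g \<otimes> k \<in> carrier G" using assms act_mult by auto
  then show ?thesis unfolding orbit_def by blast
qed

lemma act_inv_cancel:
  assumes "g \<in> carrier G" "x \<in> topspace X"
  shows "act (inv g) (act g x) = x"
  using act_mult[of "inv g" g x] act_one assms by simp

lemma orbit_closure_subset: "orbit_closure G X act z \<subseteq> topspace X"
  by (rule closure_of_subset_topspace)

lemma orbit_closure_self: "z \<in> topspace X \<Longrightarrow> z \<in> orbit_closure G X act z"
  using closure_of_subset[OF orbit_subset] orbit_self by blast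

lemma orbit_closure_invariant:
  assumes "z \<in> topspace X" "g \<in> carrier G" "x \<in> orbit_closure G X act z"
  shows "act g x \<in> orbit_closure G X act z"
proof -
  have "act g ` (X closure_of orbit G act z) \<subseteq> X closure_of (act g ` orbit G act z)"
    by (rule continuous_map_image_closure_subset[OF act_continuous_space[OF assms(2)]])
  also have "\<dots> \<subseteq> X closure_of orbit G act z"
    using orbit_invariant[OF assms(1,2)] by (intro closure_of_mono) auto
  finally show ?thesis using assms(3) by blast
qed

lemma openin_act_preimage:
  assumes "Y \<subseteq> topspace X" "\<And>x. x \<in> Y \<Longrightarrow> act g x \<in> Y" "g \<in> carrier G" "openin (subtopology X Y) U"
  shows "openin (subtopology X Y) {x \<in> Y. act g x \<in> U}"
proof -
  have "continuous_map (subtopology X Y) (subtopology X Y) (act g)"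
    using act_continuous_space[OF assms(3)] assms(2)
    by (auto simp: continuous_map_in_subtopology continuous_map_from_subtopology)
  from openin_continuous_map_preimage[OF this assms(4)] show ?thesis
    unfolding topspace_subtopology_subset[OF assms(1)] .
qed

lemma representation_equicontinuous_on_orbit_closure:
  fixes V :: "'v::real_normed_vector set"
  assumes asp: "asplund V" and rep: "flow_representation G TG X act V h \<alpha>"
    and z: "z \<in> topspace X" and v: "v \<in> V" and "e > 0"
  shows "\<exists>U. openin (subtopology X (orbit_closure G X act z)) U \<and> z \<in> U \<and>
    (\<forall>x\<in>U. \<forall>g\<in>carrier G. \<bar>\<alpha> (act g x) v - \<alpha> (act g z) v\<bar> < e)"
proof -
  let ?C = "orbit_closure G X act z"
  let ?Y = "subtopology X ?C"
  have V: "subspace V" using asp unfolding asplund_def banach_subspace_def by blast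
  have \<alpha>: "continuous_map X (dual_ball_topology V) \<alpha>"
    and equiv: "\<And>g x v. g \<in> carrier G \<Longrightarrow> x \<in> topspace X \<Longrightarrow> v \<in> V \<Longrightarrow> \<alpha> (act g x) v = \<alpha> x (h g v)"
    using rep unfolding flow_representation_def by auto
  \<comment> \<open>Contractivity is contained in the continuity of \<open>h\<close>: the target
    topology has \<open>contractions V\<close> as underlying restriction.\<close>
  have h: "h g \<in> contractions V" if "g \<in> carrier G" for g
  proof -
    have "h g \<in> topspace (weak_operator_topology V)"
      using rep that topspace_group continuous_map_image_subset_topspace
      unfolding flow_representation_def by blast
    then show ?thesis unfolding weak_operator_topology_def topspace_pullback_topology by blast
  qed
  have hV: "h g v \<in> V" "norm (h g v) \<le> norm v" if "g \<in> carrier G" for g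
    using h[OF that] v onorm_on_le_1_iff[of "h g" V V] V
    unfolding contractions_def by (auto simp: bounded_operators_def)
  let ?A = "\<alpha> ` ?C"
  \<comment> \<open>The summand \<open>1\<close> covers \<open>v = 0\<close> and makes
    \<open>d * norm v < e\<close> strict.\<close>
  define d where "d = e / (norm v + 1)"
  have "d > 0" unfolding d_def using \<open>e > 0\<close> by (simp add: add_nonneg_pos)
  have "norm v + 1 > 0" by (simp add: add_nonneg_pos)
  then have "d * norm v < e" unfolding d_def using \<open>e > 0\<close> by (simp add: field_simps)
  have "?A \<subseteq> dual_ball V"
    using continuous_map_image_subset_topspace[OF \<alpha>] orbit_closure_subset
    unfolding topspace_dual_ball_topology by blast
  moreover have "?A \<noteq> {}" using orbit_closure_self[OF z] by blast
  ultimately obtain M where M: "openin (dual_ball_topology V) M" "M \<inter> ?A \<noteq> {}"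
    and small: "\<And>f g u. f \<in> M \<inter> ?A \<Longrightarrow> g \<in> M \<inter> ?A \<Longrightarrow> u \<in> V \<Longrightarrow> \<bar>f u - g u\<bar> \<le> d * norm u"
    using asplund_dual_ball_fragmented[OF asp _ _ \<open>d > 0\<close>] by meson
  define N where "N = {x \<in> topspace X. \<alpha> x \<in> M}"
  have N: "openin X N" unfolding N_def by (rule openin_continuous_map_preimage[OF \<alpha> M(1)])
  \<comment> \<open>\<open>N\<close> is open and meets the closure of the orbit, hence the
    orbit.\<close>
  obtain y where "y \<in> ?C" "y \<in> N" using M(2) orbit_closure_subset unfolding N_def by blast
  then obtain g where g: "g \<in> carrier G" "act g z \<in> N"
    using N unfolding in_closure_of orbit_def by blast
  define U where "U = {x \<in> ?C. act g x \<in> ?C \<inter> N}"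
  have "openin ?Y U"
    unfolding U_def
  proof (rule openin_act_preimage[OF orbit_closure_subset orbit_closure_invariant[OF z g(1)] g(1)])
    show "openin ?Y (?C \<inter> N)" using N by (rule openin_subtopology_Int2)
  qed
  moreover have "z \<in> U"
    unfolding U_def using g orbit_closure_self[OF z] orbit_closure_invariant[OF z] by blast
  moreover have "\<bar>\<alpha> (act k x) v - \<alpha> (act k z) v\<bar> < e" if x: "x \<in> U" and k: "k \<in> carrier G" for x k
  proof -
    \<comment> \<open>Since \<open>k\<close> acts as \<open>l\<close> after \<open>g\<close>, the
      representation moves \<open>l\<close> onto the vector: both functionals stay in the small
      piece, and only \<open>v\<close> is replaced by \<open>h l v\<close>, of no larger norm. This
      makes the bound independent of \<open>k\<close>.\<close>
    define l where "l = k \<otimes> inv g"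
    have l: "l \<in> carrier G" unfolding l_def using g k by simp
    have "\<alpha> (act k y) v = \<alpha> (act g y) (h l v)" if y: "y \<in> U" for y
    proof -
      have yX: "y \<in> topspace X" using y orbit_closure_subset unfolding U_def by blast
      have "act l (act g y) = act k (act (inv g) (act g y))"
        unfolding l_def using act_mult[of k "inv g" "act g y"] act_closed yX g k by simp
      then have "act l (act g y) = act k y" using act_inv_cancel g yX by simp
      then show ?thesis using equiv[OF l act_closed[OF g(1) yX] v] by simp
    qed
    then have "\<bar>\<alpha> (act k x) v - \<alpha> (act k z) v\<bar> = \<bar>\<alpha> (act g x) (h l v) - \<alpha> (act g z) (h l v)\<bar>"
      using x \<open>z \<in> U\<close> by simp
    also have "\<dots> \<le> d * norm (h l v)"
      using x \<open>z \<in> U\<close> hV(1)[OF l] unfolding U_def N_def by (intro small) auto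
    also have "\<dots> \<le> d * norm v" using hV(2)[OF l] \<open>d > 0\<close> by simp
    finally show ?thesis using \<open>d * norm v < e\<close> by simp
  qed
  ultimately show ?thesis by blast
qed

section \<open>Quasiminimal subspaces and orbits\<close>

text \<open>The interior of the orbit closure is nonempty, so it meets the orbit at some
  \<open>act g y\<close>; pulling it back along \<open>act g\<close> gives a neighbourhood of
  \<open>y\<close>, and invariance under \<open>inv g\<close> keeps it in the closure. The closure
  is passed from \<open>Y\<close> to \<open>X\<close>, where local equicontinuity is
  available.\<close>

lemma quasiminimal_nbhd:
  assumes "quasiminimal_subspace G X act Y" "y \<in> Y"
  shows "\<exists>U. openin (subtopology X Y) U \<and> y \<in> U \<and> U \<subseteq> orbit_closure G X act y"
proof -
  let ?Y = "subtopology X Y"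
  have Y: "Y \<subseteq> topspace X" and inv: "\<And>g y. g \<in> carrier G \<Longrightarrow> y \<in> Y \<Longrightarrow> act g y \<in> Y"
    and "?Y interior_of (?Y closure_of orbit G act y) \<noteq> {}"
    using assms unfolding quasiminimal_subspace_def quasiminimal_flow_def by auto
  then obtain N where N: "openin ?Y N" "N \<noteq> {}" "N \<subseteq> ?Y closure_of orbit G act y"
    using openin_interior_of interior_of_subset by metis
  then obtain g where g: "g \<in> carrier G" "act g y \<in> N"
    unfolding orbit_def in_closure_of subset_iff by blast
  have yX: "y \<in> topspace X" using assms(2) Y by blast
  have cl: "?Y closure_of orbit G act y \<subseteq> orbit_closure G X act y"
    by (rule closure_of_subtopology_subset)
  let ?U = "{x \<in> Y. act g x \<in> N}"
  have "openin ?Y ?U" using openin_act_preimage[OF Y inv[OF g(1)] g(1) N(1)] .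
  moreover have "x \<in> orbit_closure G X act y" if "x \<in> ?U" for x
  proof -
    have "act (inv g) (act g x) \<in> orbit_closure G X act y"
      by (rule orbit_closure_invariant[OF yX]) (use that N(3) cl g in auto)
    then show ?thesis using act_inv_cancel[OF g(1)] that Y by auto
  qed
  ultimately show ?thesis using g assms(2) by blast
qed

text \<open>Each point of an orbit generates the whole orbit, so within that subspace its orbit
  closure is everything.\<close>

lemma quasiminimal_orbit:
  assumes z: "z \<in> topspace X"
  shows "quasiminimal_subspace G X act (orbit G act z)"
  unfolding quasiminimal_subspace_def quasiminimal_flow_def
proof (intro conjI ballI)
  let ?O = "orbit G act z"
  have top: "topspace (subtopology X ?O) = ?O"
    using orbit_subset[OF z] by (rule topspace_subtopology_subset)
  show "?O \<subseteq> topspace X" using orbit_subset[OF z] .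
  show "\<And>g y. g \<in> carrier G \<Longrightarrow> y \<in> ?O \<Longrightarrow> act g y \<in> ?O" by (rule orbit_invariant[OF z])
  fix y assume "y \<in> topspace (subtopology X ?O)"
  then have y: "y \<in> ?O" using top by simp
  then obtain k where k: "k \<in> carrier G" "y = act k z" unfolding orbit_def by auto
  have yX: "y \<in> topspace X" using y orbit_subset[OF z] by blast
  have "act g z \<in> orbit G act y" if g: "g \<in> carrier G" for g
  proof -
    have "act g z = act (g \<otimes> inv k) y"
      using act_mult[of g "inv k" y] act_inv_cancel[OF k(1) z] k g yX by simp
    then show ?thesis unfolding orbit_def using g k by blast
  qed
  then have "?O \<subseteq> orbit G act y" unfolding orbit_def[of G act z] by blast
  moreover have "orbit G act y \<subseteq> ?O"
    using orbit_invariant[OF z _ y] unfolding orbit_def[of G act y] by blast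
  ultimately have "orbit G act y = topspace (subtopology X ?O)" using top by simp
  then have "orbit_closure G (subtopology X ?O) act y = topspace (subtopology X ?O)"
    by (simp only: closure_of_topspace)
  then show "subtopology X ?O interior_of orbit_closure G (subtopology X ?O) act y \<noteq> {}"
    using interior_of_topspace[of "subtopology X ?O"] top y by auto
qed

end

theorem theorem6p10:
  fixes G :: "('g, 'm) monoid_scheme" and TG :: "'g topology"
    and X :: "'x topology" and act :: "'g \<Rightarrow> 'x \<Rightarrow> 'x"
  assumes "semitopological_group G TG"
    and "semitopological_flow G TG X act"
    and "RN_approximable TYPE('i) TYPE('v::real_normed_vector) G TG X act"
  shows "locally_equicontinuous G X act \<and>
    (\<forall>Y. quasiminimal_subspace G X act Y \<longrightarrow> equicontinuous_flow G (subtopology X Y) act) \<and>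
    (\<forall>z\<in>topspace X. quasiminimal_subspace G X act (orbit G act z) \<and>
       equicontinuous_flow G (subtopology X (orbit G act z)) act)"
proof -
  interpret semitopological_flow G TG X act by fact
  obtain I :: "'i set" and V :: "'i \<Rightarrow> 'v set" and h \<alpha> where
    asp_rep: "\<forall>i\<in>I. asplund (V i) \<and> flow_representation G TG X act (V i) (h i) (\<alpha> i)"
    and sep: "\<forall>F. closedin X F \<longrightarrow> (\<forall>x\<in>topspace X - F.
      \<exists>i\<in>I. \<alpha> i x \<notin> dual_ball_topology (V i) closure_of (\<alpha> i ` F))"
    using assms(3) unfolding RN_approximable_def by (elim exE conjE) (rule that)
  then have asp: "asplund (V i)" and rep: "flow_representation G TG X act (V i) (h i) (\<alpha> i)"
    if "i \<in> I" for i
    using that by auto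
  define P where "P = {\<lambda>x. \<alpha> i x v |i v. i \<in> I \<and> v \<in> V i}"
  have \<alpha>: "continuous_map X (dual_ball_topology (V i)) (\<alpha> i)" if "i \<in> I" for i
    using rep[OF that] unfolding flow_representation_def by blast
  have contP: "continuous_map X euclideanreal p" if pP: "p \<in> P" for p
  proof -
    obtain i v where p: "p = (\<lambda>x. \<alpha> i x v)" "i \<in> I" "v \<in> V i" using pP unfolding P_def by blast
    show ?thesis
      using continuous_map_compose[OF \<alpha>[OF p(2)] continuous_map_dual_ball_eval[OF p(3)]]
      unfolding p(1) comp_def .
  qed
  \<comment> \<open>A point outside a weak-star closure has a basic neighbourhood missing the set;
    its finitely many vectors, all from one \<open>V i\<close>, give the functions in
    \<open>Q\<close>.\<close>
  have sepP: "\<exists>Q e. finite Q \<and> Q \<subseteq> P \<and> e > 0 \<and> (\<forall>y\<in>F. \<exists>p\<in>Q. e \<le> \<bar>p x - p y\<bar>)"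
    if F: "closedin X F" and x: "x \<in> topspace X" "x \<notin> F" for F x
  proof -
    obtain i where i: "i \<in> I" "\<alpha> i x \<notin> dual_ball_topology (V i) closure_of (\<alpha> i ` F)"
      using sep F x by blast
    have ball: "\<alpha> i y \<in> dual_ball (V i)" if "y \<in> topspace X" for y
      using \<alpha>[OF i(1)] that continuous_map_image_subset_topspace topspace_dual_ball_topology by fastforce
    obtain T where T: "openin (dual_ball_topology (V i)) T" "\<alpha> i x \<in> T" "T \<inter> \<alpha> i ` F = {}"
      using i(2) ball[OF x(1)] unfolding in_closure_of topspace_dual_ball_topology by blast
    obtain R e where R: "finite R" "R \<subseteq> V i" "e > 0"
      "\<And>g. g \<in> dual_ball (V i) \<Longrightarrow> (\<And>v. v \<in> R \<Longrightarrow> \<bar>\<alpha> i x v - g v\<bar> < e) \<Longrightarrow> g \<in> T"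
      using dual_ball_nbhd[OF T(1,2)] by blast
    let ?Q = "(\<lambda>v x. \<alpha> i x v) ` R"
    have "\<exists>p\<in>?Q. e \<le> \<bar>p x - p y\<bar>" if "y \<in> F" for y
    proof -
      have "\<alpha> i y \<in> dual_ball (V i)" "\<alpha> i y \<notin> T"
        using that closedin_subset[OF F] ball T(3) by auto
      then obtain v where "v \<in> R" "\<not> \<bar>\<alpha> i x v - \<alpha> i y v\<bar> < e" using R(4) by blast
      then show ?thesis by (intro bexI[of _ "\<lambda>x. \<alpha> i x v"]) auto
    qed
    moreover have "?Q \<subseteq> P" unfolding P_def using R(2) i(1) by blast
    ultimately show ?thesis using R(1,3) by blast
  qed
  have orbP: "\<exists>U. openin (subtopology X (orbit_closure G X act z)) U \<and> z \<in> U \<and>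
      (\<forall>x\<in>U. \<forall>g\<in>carrier G. \<bar>p (act g x) - p (act g z)\<bar> < e)"
    if "z \<in> topspace X" "p \<in> P" "e > 0" for z p e
  proof -
    obtain i v where p: "p = (\<lambda>x. \<alpha> i x v)" "i \<in> I" "v \<in> V i" using \<open>p \<in> P\<close> unfolding P_def by blast
    show ?thesis
      using representation_equicontinuous_on_orbit_closure[OF asp rep that(1) _ that(3)] p by blast
  qed
  have LE: "locally_equicontinuous G X act"
    unfolding locally_equicontinuous_def
  proof (intro exI conjI ballI)
    show "compatible_uniformity X (weak_uniformity (topspace X) P)"
      using contP sepP by (rule compatible_weak_uniformity)
    fix z assume z: "z \<in> topspace X"
    let ?C = "orbit_closure G X act z"
    have top: "topspace (subtopology X ?C) = ?C"
      using orbit_closure_subset by (rule topspace_subtopology_subset)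
    have "equicontinuity_point G (subtopology X ?C) act (weak_uniformity (topspace (subtopology X ?C)) P) z"
    proof (rule equicontinuity_point_weak_uniformity)
      show "z \<in> topspace (subtopology X ?C)" unfolding top by (rule orbit_closure_self[OF z])
      show "\<And>g x. g \<in> carrier G \<Longrightarrow> x \<in> topspace (subtopology X ?C) \<Longrightarrow> act g x \<in> topspace (subtopology X ?C)"
        unfolding top by (rule orbit_closure_invariant[OF z])
    qed (rule orbP[OF z])
    then show "equicontinuity_point G (subtopology X ?C) act
        (uniformity_restrict (weak_uniformity (topspace X) P) ?C) z"
      unfolding top uniformity_restrict_weak[OF orbit_closure_subset] .
  qed
  have QM: "equicontinuous_flow G (subtopology X Y) act" if qm: "quasiminimal_subspace G X act Y" for Y
    unfolding equicontinuous_flow_def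
  proof (intro exI conjI ballI)
    let ?Y = "subtopology X Y"
    have Y: "Y \<subseteq> topspace X" and inv: "\<And>g y. g \<in> carrier G \<Longrightarrow> y \<in> Y \<Longrightarrow> act g y \<in> Y"
      using qm unfolding quasiminimal_subspace_def by auto
    have top: "topspace ?Y = Y" using Y by (rule topspace_subtopology_subset)
    show "compatible_uniformity ?Y (weak_uniformity (topspace ?Y) P)"
    proof (rule compatible_weak_uniformity)
      show "continuous_map ?Y euclideanreal p" if "p \<in> P" for p
        using contP[OF that] by (rule continuous_map_from_subtopology)
      fix F x assume "closedin ?Y F" "x \<in> topspace ?Y" "x \<notin> F"
      then obtain F' where "closedin X F'" "F = F' \<inter> Y" "x \<in> topspace X" "x \<notin> F'"
        unfolding closedin_subtopology by auto
      then show "\<exists>Q e. finite Q \<and> Q \<subseteq> P \<and> e > 0 \<and> (\<forall>y\<in>F. \<exists>p\<in>Q. e \<le> \<bar>p x - p y\<bar>)"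
        using sepP[of F' x] by (metis IntE)
    qed
    fix y assume "y \<in> topspace ?Y"
    then have y: "y \<in> Y" "y \<in> topspace X" using top Y by auto
    let ?C = "orbit_closure G X act y"
    obtain N where N: "openin ?Y N" "y \<in> N" "N \<subseteq> ?C" using quasiminimal_nbhd[OF qm y(1)] by blast
    show "equicontinuity_point G ?Y act (weak_uniformity (topspace ?Y) P) y"
    proof (rule equicontinuity_point_weak_uniformity)
      fix p and e :: real assume "p \<in> P" "e > 0"
      then obtain U where U: "openin (subtopology X ?C) U" "y \<in> U"
        "\<forall>x\<in>U. \<forall>g\<in>carrier G. \<bar>p (act g x) - p (act g y)\<bar> < e"
        using orbP[OF y(2)] by blast
      then obtain T where T: "openin X T" "U = T \<inter> ?C" unfolding openin_subtopology by blast
      \<comment> \<open>\<open>U\<close> is open only relative to the orbit closure. Cutting its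
        open extension \<open>T\<close> down to \<open>N\<close>, which lies in that closure, yields
        a neighbourhood relative to \<open>Y\<close> inside \<open>U\<close>.\<close>
      have "openin ?Y ((Y \<inter> T) \<inter> N)"
        using T(1) N(1) by (intro openin_Int openin_subtopology_Int2)
      moreover have "(Y \<inter> T) \<inter> N \<subseteq> U" "y \<in> (Y \<inter> T) \<inter> N" using T(2) N(2,3) U(2) y by auto
      ultimately show "\<exists>U. openin ?Y U \<and> y \<in> U \<and>
          (\<forall>x\<in>U. \<forall>g\<in>carrier G. \<bar>p (act g x) - p (act g y)\<bar> < e)"
        using U(3) by blast
    qed (use top y inv in auto)
  qed
  show ?thesis using LE QM quasiminimal_orbit by blast
qed

end
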